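(* There is a compact set $K \subset \mathbb{R}^2$ with $\dim_{\rm H}(K) = 0$ that can not be covered by a countable collection of $\alpha$-Hölder curves for any $\alpha > \frac{1}{2}$; i.e. for every $\alpha > \frac12$ there is no countable family of $\alpha$-Hölder maps $f_i : [0,1] \to \mathbb{R}^2$, $i \in \mathbb{N}$, with $K \subset \bigcup_{i \in \mathbb{N}} f_i([0,1])$.
   Context: $\dim_{\rm H}$ denotes Hausdorff dimension. For $\alpha > 0$, a map $f : [0,1] \to \mathbb{R}^2$ is $\alpha$-Hölder (an $\alpha$-Hölder curve) if there is a constant $L \geq 0$ with $|f(s)-f(t)| \leq L|s-t|^\alpha$ for all $s,t \in [0,1]$. Different curves of a collection may have different constants $L$. *)

theory Defs
  imports "HOL-Analysis.Analysis"
begin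

(* The usual conventions for diam(U)^s: the empty set contributes 0, also for s = 0, and
   diam(U)^0 = 1 for nonempty U, also when diam(U) = 0 (whereas 0 powr 0 = 0 in HOL). *)
definition diam_pow :: "real \<Rightarrow> 'a::metric_space set \<Rightarrow> ennreal" where
  "diam_pow s U =
     (if U = {} then 0 else if s = 0 then 1 else ennreal (diameter U powr s))"

(* Boundedness is required explicitly because diameter is unspecified on unbounded sets. *)
definition hausdorff_premeasure :: "real \<Rightarrow> real \<Rightarrow> 'a::metric_space set \<Rightarrow> ennreal" where
  "hausdorff_premeasure s \<delta> A =
     Inf {(\<Sum>i. diam_pow s (U i)) | U :: nat \<Rightarrow> 'a set.
            A \<subseteq> (\<Union>i. U i) \<and> (\<forall>i. bounded (U i) \<and> diameter (U i) \<le> \<delta>)}"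

definition hausdorff_measure :: "real \<Rightarrow> 'a::metric_space set \<Rightarrow> ennreal" where
  "hausdorff_measure s A = (SUP \<delta>\<in>{0<..}. hausdorff_premeasure s \<delta> A)"

(* The infimum is taken in [0, \<infinity>]: it is \<infinity> if there is no such s, and 0 for the empty set. *)
definition hausdorff_dim :: "'a::metric_space set \<Rightarrow> ennreal" where
  "hausdorff_dim A = Inf {ennreal s | s. 0 \<le> s \<and> hausdorff_measure s A = 0}"

(* Only the restriction of f to [0,1] matters. *)
definition holder_curve :: "real \<Rightarrow> (real \<Rightarrow> 'a::metric_space) \<Rightarrow> bool" where
  "holder_curve \<alpha> f \<longleftrightarrow>
     (\<exists>L\<ge>0. \<forall>s\<in>{0..1}. \<forall>t\<in>{0..1}. dist (f s) (f t) \<le> L * \<bar>s - t\<bar> powr \<alpha>)"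

end

theory Submission
  imports Defs
begin

text \<open>
  Hausdorff dimension sees only the best scales of a set, whereas a covering by Hoelder curves is
  obstructed already by the worst ones.  The set used here alternates between the two: points whose
  coordinates have binary digits that are free at the positions in the blocks from \<open>(2n)!\<close> up to
  \<open>(2n+1)!\<close> and that vanish at the positions from \<open>(2n+1)!\<close> up to \<open>(2n+2)!\<close>.

  At the end of a block of zeros, each of the at most \<open>4 ^ (2n+1)!\<close> prefixes leaves only a
  square of side \<open>2 ^ - (2n+2)!\<close>, which is the \<open>(2n+2)\<close>-nd power of \<open>2 ^ - (2n+1)!\<close>; so the
  Hausdorff measure vanishes in every positive dimension (\<open>hausdorff_dim_lacunary_set\<close>).

  At the end of a free block, with \<open>a = (2n)!\<close> and \<open>b = (2n+1)!\<close>, every relatively open piece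
  of the set contains \<open>4 ^ (b - a)\<close> points that are \<open>2 ^ - b\<close>-separated.  If these points lay on
  one curve, two of their parameters would differ by at most about \<open>4 ^ - (b - a)\<close>, and an
  \<open>\<alpha>\<close>-Hoelder bound would give \<open>2 ^ - b \<le> L * 4 ^ (- \<alpha> * (b - a))\<close> up to a constant.  As
  \<open>a / b\<close> tends to 0, this fails for large \<open>n\<close> as soon as \<open>2 * \<alpha> > 1\<close>.  Hence each Hoelder
  curve is nowhere dense in the set (\<open>holder_curve_nowhere_dense\<close>), and Baire's theorem excludes
  a covering by countably many of them.
\<close>

section \<open>Null sets for Hausdorff measure\<close>

text \<open>
  Finitely many balls of one common radius suffice for the set constructed below, and they avoid
  infinite sums: the countable covering of the definition is padded with empty sets, which cost 0.
\<close>

lemma hausdorff_measure_eq_0I: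
  fixes A :: "'a::metric_space set"
  assumes s: "s > 0"
    and cover: "\<And>\<delta> \<epsilon>. \<delta> > 0 \<Longrightarrow> \<epsilon> > 0 \<Longrightarrow> \<exists>P r. finite P \<and> 0 \<le> r \<and> 2 * r \<le> \<delta> \<and>
          A \<subseteq> (\<Union>p\<in>P. cball p r) \<and> real (card P) * (2 * r) powr s \<le> \<epsilon>"
  shows "hausdorff_measure s A = 0"
proof -
  have premeasure_le: "hausdorff_premeasure s \<delta> A \<le> ennreal \<epsilon>" if "\<delta> > 0" "\<epsilon> > 0" for \<delta> \<epsilon>
  proof -
    obtain P r where P: "finite P" "0 \<le> r" "2 * r \<le> \<delta>" "A \<subseteq> (\<Union>p\<in>P. cball p r)"
      and le: "real (card P) * (2 * r) powr s \<le> \<epsilon>"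
      using cover[OF \<open>\<delta> > 0\<close> \<open>\<epsilon> > 0\<close>] by blast
    obtain h where h: "bij_betw h {..<card P} P"
      using ex_bij_betw_nat_finite[OF P(1)] by (auto simp: atLeast0LessThan)
    define U where "U i = (if i < card P then cball (h i) r else {})" for i
    have diam: "diameter (cball p r) \<le> 2 * r" for p :: 'a
    proof -
      have "dist x y \<le> 2 * r" if "x \<in> cball p r" "y \<in> cball p r" for x y
        using that dist_triangle3[of x y p] by auto
      then show ?thesis
        using P(2) unfolding diameter_def by (auto intro!: cSUP_least)
    qed
    have "A \<subseteq> (\<Union>i. U i)"
    proof
      fix x assume "x \<in> A"
      then obtain p where p: "p \<in> P" "x \<in> cball p r" using P(4) by auto
      have "p \<in> h ` {..<card P}" using h p(1) by (simp add: bij_betw_def)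
      then obtain i where "i < card P" "h i = p" by blast
      then show "x \<in> (\<Union>i. U i)" using p by (auto simp: U_def intro!: exI[of _ i])
    qed
    moreover have "bounded (U i) \<and> diameter (U i) \<le> \<delta>" for i
      using diam[of "h i"] P(3) \<open>\<delta> > 0\<close> by (auto simp: U_def)
    ultimately have "hausdorff_premeasure s \<delta> A \<le> (\<Sum>i. diam_pow s (U i))"
      unfolding hausdorff_premeasure_def by (intro Inf_lower) blast
    also have "\<dots> = (\<Sum>i<card P. diam_pow s (U i))"
      by (intro suminf_finite) (auto simp: U_def diam_pow_def)
    also have "\<dots> \<le> (\<Sum>i<card P. ennreal ((2 * r) powr s))"
    proof (rule sum_mono)
      fix i assume "i \<in> {..<card P}"
      then have "U i = cball (h i) r" by (simp add: U_def)
      moreover have "diameter (cball (h i) r) powr s \<le> (2 * r) powr s"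
        using s diam[of "h i"] by (intro powr_mono2) (auto simp: diameter_ge_0)
      ultimately show "diam_pow s (U i) \<le> ennreal ((2 * r) powr s)"
        using s by (auto simp: diam_pow_def ennreal_leI)
    qed
    also have "\<dots> = ennreal (real (card P) * (2 * r) powr s)"
      by (simp add: ennreal_mult ennreal_of_nat_eq_real_of_nat)
    also have "\<dots> \<le> ennreal \<epsilon>" using le by (rule ennreal_leI)
    finally show ?thesis .
  qed
  have "hausdorff_premeasure s \<delta> A \<le> 0" if "\<delta> > 0" for \<delta>
    by (rule ennreal_le_epsilon) (use premeasure_le that in simp)
  then show ?thesis
    unfolding hausdorff_measure_def by (intro antisym SUP_least) auto
qed

lemma hausdorff_dim_eq_0I:
  assumes "\<And>s. s > 0 \<Longrightarrow> hausdorff_measure s A = 0"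
  shows "hausdorff_dim A = 0"
proof -
  have dim_le: "hausdorff_dim A \<le> ennreal s" if "s > 0" for s
    unfolding hausdorff_dim_def using assms[OF that] that by (intro Inf_lower) auto
  have "hausdorff_dim A \<le> 0" by (rule ennreal_le_epsilon) (simp add: dim_le)
  then show ?thesis by simp
qed

section \<open>Hoelder curves\<close>

lemma holder_curve_continuous_on:
  assumes "holder_curve \<alpha> f" "\<alpha> > 0"
  shows "continuous_on {0..1} f"
proof -
  obtain L where L: "\<forall>s\<in>{0..1}. \<forall>t\<in>{0..1}. dist (f s) (f t) \<le> L * \<bar>s - t\<bar> powr \<alpha>"
    using assms(1) by (auto simp: holder_curve_def)
  show ?thesis
    unfolding continuous_on_def
  proof
    fix t :: real assume t: "t \<in> {0..1}"
    have "((\<lambda>s. L * \<bar>s - t\<bar> powr \<alpha>) \<longlongrightarrow> L * \<bar>t - t\<bar> powr \<alpha>) (at t within {0..1})"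
      using assms(2) by (intro tendsto_intros) auto
    then have lim: "((\<lambda>s. L * \<bar>s - t\<bar> powr \<alpha>) \<longlongrightarrow> 0) (at t within {0..1})" by simp
    have "((\<lambda>s. dist (f s) (f t)) \<longlongrightarrow> 0) (at t within {0..1})"
      by (rule tendsto_sandwich[OF _ _ tendsto_const lim])
        (use L t in \<open>auto simp: eventually_at_filter\<close>)
    then show "(f \<longlongrightarrow> f t) (at t within {0..1})" by (rule tendsto_dist_iff[THEN iffD2])
  qed
qed

text \<open>
  Cut the parameter interval into pieces of length \<open>1 / N\<close>: by the pigeonhole principle two of the
  given points have parameters in the same piece.  The bound on \<open>card P\<close> is \<open>N + 1\<close> because the
  parameter 1 forms a piece of its own.
\<close>

lemma holder_curve_close_points:
  fixes f :: "real \<Rightarrow> 'a::metric_space"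
  assumes holder: "\<forall>s\<in>{0..1}. \<forall>t\<in>{0..1}. dist (f s) (f t) \<le> L * \<bar>s - t\<bar> powr \<alpha>"
    and "L \<ge> 0" "\<alpha> > 0" "N > 0"
    and P: "P \<subseteq> f ` {0..1}" "card P > N + 1"
  shows "\<exists>x\<in>P. \<exists>y\<in>P. x \<noteq> y \<and> dist x y \<le> L * (1 / real N) powr \<alpha>"
proof -
  define u where "u = inv_into {0..1} f"
  have u: "u x \<in> {0..1} \<and> f (u x) = x" if "x \<in> P" for x
    using P(1) that f_inv_into_f[of x f] inv_into_into[of x f] unfolding u_def by blast
  define c where "c x = nat \<lfloor>u x * real N\<rfloor>" for x
  have "c ` P \<subseteq> {..N}"
  proof
    fix k assume "k \<in> c ` P"
    then obtain x where x: "x \<in> P" "k = c x" by blast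
    have "u x * real N \<le> 1 * real N" using u[OF x(1)] by (intro mult_right_mono) auto
    then show "k \<in> {..N}" using x by (simp add: c_def nat_le_iff floor_le_iff)
  qed
  then have "card (c ` P) \<le> card {..N}" by (intro card_mono) auto
  then have "\<not> inj_on c P" using P(2) by (intro pigeonhole) simp
  then obtain x y where xy: "x \<in> P" "y \<in> P" "x \<noteq> y" "c x = c y" by (auto simp: inj_on_def)
  have fl: "\<lfloor>u x * real N\<rfloor> = \<lfloor>u y * real N\<rfloor>"
    using xy u[of x] u[of y] by (simp add: c_def eq_nat_nat_iff)
  have "\<bar>u x * real N - u y * real N\<bar> \<le> 1"
    using fl by linarith
  then have "\<bar>u x - u y\<bar> * real N \<le> 1"
    by (simp add: abs_mult left_diff_distrib[symmetric])
  then have "\<bar>u x - u y\<bar> \<le> 1 / real N" using \<open>N > 0\<close> by (simp add: field_simps)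
  then have "L * \<bar>u x - u y\<bar> powr \<alpha> \<le> L * (1 / real N) powr \<alpha>"
    using assms(2,3) by (intro mult_left_mono powr_mono2) auto
  moreover have "dist x y \<le> L * \<bar>u x - u y\<bar> powr \<alpha>"
    using holder u[OF xy(1)] u[OF xy(2)] by metis
  ultimately show ?thesis using xy by (meson order_trans)
qed

section \<open>A compact set of lacunary dyadic expansions\<close>

text \<open>
  Free digits occupy the positions from \<open>coarse_exp n\<close> up to \<open>fine_exp n\<close>.  Both quotients
  \<open>fine_exp n / coarse_exp n\<close> and \<open>coarse_exp (Suc n) / fine_exp n\<close> must tend to infinity: the
  first makes the set large at the fine scales, the second makes it small at the coarse scales.
\<close>

definition coarse_exp :: "nat \<Rightarrow> nat" where
  "coarse_exp n = fact (2 * n)"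

definition fine_exp :: "nat \<Rightarrow> nat" where
  "fine_exp n = fact (2 * n + 1)"

lemma fine_exp_eq: "fine_exp n = (2 * n + 1) * coarse_exp n"
  by (simp add: fine_exp_def coarse_exp_def)

lemma coarse_exp_Suc: "coarse_exp (Suc n) = (2 * n + 2) * fine_exp n"
  by (simp add: fine_exp_def coarse_exp_def)

lemma coarse_exp_le_fine_exp: "coarse_exp n \<le> fine_exp n"
  by (simp add: fine_exp_eq)

lemma le_coarse_exp: "n \<le> coarse_exp n"
  using fact_ge_self[of "2 * n"] unfolding coarse_exp_def by linarith

lemma le_fine_exp: "n \<le> fine_exp n"
  using le_coarse_exp coarse_exp_le_fine_exp order_trans by blast

lemma coarse_exp_pos: "coarse_exp n > 0"
  by (simp add: coarse_exp_def)

lemma coarse_exp_less_Suc: "coarse_exp n < coarse_exp (Suc n)"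
  using coarse_exp_pos[of n] by (simp add: coarse_exp_Suc fine_exp_eq)

definition grid_pt :: "nat \<Rightarrow> nat \<times> nat \<Rightarrow> real ^ 2" where
  "grid_pt n = (\<lambda>(i, j). (1 / 2) ^ fine_exp n *\<^sub>R vector [real i, real j])"

text \<open>
  The contribution of the \<open>n\<close>-th block of free digits to the two coordinates.  Numbering the digit
  strings of a block by an integer makes their separation immediate.
\<close>

definition grid :: "nat \<Rightarrow> (real ^ 2) set" where
  "grid n = grid_pt n ` ({..<2 ^ (fine_exp n - coarse_exp n)} \<times> {..<2 ^ (fine_exp n - coarse_exp n)})"

text \<open>
  Stated for indices instead of points, so that it also yields the injectivity of \<open>grid_pt n\<close>.
\<close>

lemma dist_grid_pt:
  assumes "p \<noteq> q"
  shows "(1 / 2) ^ fine_exp n \<le> dist (grid_pt n p) (grid_pt n q)"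
proof -
  obtain i j i' j' where pq: "p = (i, j)" "q = (i', j')" by (cases p, cases q)
  let ?h = "(1 / 2 :: real) ^ fine_exp n"
  have comp: "?h * \<bar>real a - real b\<bar> \<le> dist (grid_pt n p) (grid_pt n q)"
    if "a = i \<and> b = i' \<or> a = j \<and> b = j'" for a b
  proof -
    have "?h * \<bar>real a - real b\<bar> = \<bar>?h * real a - ?h * real b\<bar>"
      by (simp add: right_diff_distrib[symmetric] abs_mult)
    also have "\<dots> \<le> dist (grid_pt n p) (grid_pt n q)"
      using that dist_vec_nth_le[of "grid_pt n p" 1 "grid_pt n q"]
        dist_vec_nth_le[of "grid_pt n p" 2 "grid_pt n q"]
      by (auto simp: grid_pt_def pq dist_real_def)
    finally show ?thesis .
  qed
  have ge1: "?h * 1 \<le> ?h * \<bar>real a - real b\<bar>" if "a \<noteq> b" for a b :: nat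
    using that by (intro mult_left_mono) auto
  show ?thesis
    using assms ge1[of i i'] ge1[of j j'] comp[of i i'] comp[of j j'] pq by fastforce
qed

lemma grid_separated:
  assumes "x \<in> grid n" "y \<in> grid n" "x \<noteq> y"
  shows "(1 / 2) ^ fine_exp n \<le> dist x y"
proof -
  obtain p q where "x = grid_pt n p" "y = grid_pt n q" using assms(1,2) unfolding grid_def by blast
  then show ?thesis using dist_grid_pt[of p q n] assms(3) by blast
qed

lemma finite_grid: "finite (grid n)"
  by (simp add: grid_def)

lemma card_grid: "card (grid n) = 4 ^ (fine_exp n - coarse_exp n)"
proof -
  have "inj (grid_pt n)"
  proof (rule injI, rule ccontr)
    fix p q assume "grid_pt n p = grid_pt n q" "p \<noteq> q"
    then show False using dist_grid_pt[of p q n] by (simp flip: not_less)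
  qed
  then have "card (grid n) = 2 ^ (fine_exp n - coarse_exp n) * 2 ^ (fine_exp n - coarse_exp n)"
    by (simp add: grid_def card_image inj_on_subset)
  then show ?thesis by (simp add: power_mult_distrib[symmetric])
qed

lemma zero_in_grid: "0 \<in> grid n"
  unfolding grid_def
  by (rule image_eqI[of _ _ "(0, 0)"]) (auto simp: grid_pt_def vec_eq_iff forall_2)

lemma norm_grid_le:
  assumes "g \<in> grid n"
  shows "norm g \<le> 2 * (1 / 2) ^ coarse_exp n"
proof -
  obtain i j where ij: "i < 2 ^ (fine_exp n - coarse_exp n)" "j < 2 ^ (fine_exp n - coarse_exp n)"
    and g: "g = grid_pt n (i, j)"
    using assms by (auto simp: grid_def)
  have "(1 / 2) ^ fine_exp n * real i \<le> (1 / 2) ^ coarse_exp n" if "i < 2 ^ (fine_exp n - coarse_exp n)" for i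
  proof -
    have "(1 / 2) ^ fine_exp n * real i \<le> (1 / 2) ^ fine_exp n * 2 ^ (fine_exp n - coarse_exp n)"
      using of_nat_mono[of i "2 ^ (fine_exp n - coarse_exp n)", where ?'a = real] that
      by (intro mult_left_mono) simp_all
    also have "\<dots> = (1 / 2) ^ coarse_exp n"
      by (simp add: power_diff[OF _ coarse_exp_le_fine_exp] power_one_over)
    finally show ?thesis .
  qed
  from this[OF ij(1)] this[OF ij(2)] have "(\<Sum>c\<in>UNIV. \<bar>g $ c\<bar>) \<le> 2 * (1 / 2) ^ coarse_exp n"
    by (simp add: g grid_pt_def sum_2 abs_mult)
  then show ?thesis using norm_le_l1_cart order_trans by blast
qed

fun stage :: "nat \<Rightarrow> (real ^ 2) set" where
  "stage 0 = {0}"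
| "stage (Suc n) = (\<lambda>(x, g). x + g) ` (stage n \<times> grid n)"

text \<open>
  Taking the closure of the finite expansions makes compactness immediate and replaces convergence of
  infinite expansions by density of the finite ones, which is all that the two scale estimates use.
\<close>

definition lacunary_set :: "(real ^ 2) set" where
  "lacunary_set = closure (\<Union>n. stage n)"

lemma stage_mono: "m \<le> n \<Longrightarrow> stage m \<subseteq> stage n"
proof (rule lift_Suc_mono_le[of stage])
  show "stage n \<subseteq> stage (Suc n)" for n
    using zero_in_grid[of n] by (force intro: image_eqI[of _ _ "(_, 0)"])
qed

lemma zero_in_lacunary_set: "0 \<in> lacunary_set"
  unfolding lacunary_set_def by (rule subsetD[OF closure_subset]) (auto intro: exI[of _ 0])

lemma finite_stage: "finite (stage n)"
  by (induction n) (auto simp: finite_grid)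

text \<open>
  Inductively there are at most \<open>4 ^ coarse_exp n\<close> points in \<open>stage n\<close>, as if all earlier digits
  were free; the \<open>n\<close>-th block then turns the exponent \<open>coarse_exp n\<close> into \<open>fine_exp n\<close>.
\<close>

lemma card_stage_Suc_le: "card (stage (Suc n)) \<le> 4 ^ fine_exp n"
proof -
  have step: "card (stage (Suc n)) \<le> card (stage n) * 4 ^ (fine_exp n - coarse_exp n)" for n
    using card_image_le[of "stage n \<times> grid n" "\<lambda>(x, g). x + g"]
    by (simp add: finite_stage finite_grid card_grid)
  have merge: "card (stage (Suc n)) \<le> 4 ^ fine_exp n" if "card (stage n) \<le> 4 ^ coarse_exp n" for n
  proof -
    have "card (stage (Suc n)) \<le> 4 ^ coarse_exp n * 4 ^ (fine_exp n - coarse_exp n)"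
      using step[of n] that by (meson mult_le_mono1 order_trans)
    also have "\<dots> = 4 ^ fine_exp n"
      using coarse_exp_le_fine_exp[of n] by (simp add: power_add[symmetric])
    finally show ?thesis .
  qed
  have "card (stage n) \<le> 4 ^ coarse_exp n"
  proof (induction n)
    case (Suc n)
    have "(4::nat) ^ fine_exp n \<le> 4 ^ coarse_exp (Suc n)"
      by (intro power_increasing) (auto simp: coarse_exp_Suc)
    then show ?case using merge[OF Suc] by linarith
  qed simp
  then show ?thesis by (rule merge)
qed

text \<open>
  The subtracted term makes the estimate inductive: a further block moves a point by at most
  \<open>2 * (1 / 2) ^ coarse_exp m\<close>, and since the coarse exponents increase strictly this is at most
  the increase of the right-hand side.
\<close>

lemma stage_near_earlier:
  assumes "x \<in> stage m" "n \<le> m"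
  shows "\<exists>p\<in>stage n. dist p x \<le> 4 * ((1 / 2) ^ coarse_exp n - (1 / 2) ^ coarse_exp m)"
  using assms(2,1)
proof (induction m arbitrary: x rule: dec_induct)
  case base
  then show ?case by (auto intro: bexI[of _ x])
next
  case (step m)
  obtain y g where yg: "y \<in> stage m" "g \<in> grid m" "x = y + g" using step.prems by auto
  obtain p where p: "p \<in> stage n" "dist p y \<le> 4 * ((1 / 2) ^ coarse_exp n - (1 / 2) ^ coarse_exp m)"
    using step.IH[OF yg(1)] by blast
  have "dist y x \<le> 2 * (1 / 2) ^ coarse_exp m"
    using norm_grid_le[OF yg(2)] by (simp add: yg(3) dist_norm)
  moreover have "(1 / 2 :: real) ^ coarse_exp (Suc m) \<le> (1 / 2) ^ Suc (coarse_exp m)"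
    using coarse_exp_less_Suc[of m] by (intro power_decreasing) auto
  ultimately have "dist p x \<le> 4 * ((1 / 2) ^ coarse_exp n - (1 / 2) ^ coarse_exp (Suc m))"
    using p(2) dist_triangle[of p x y] by simp
  then show ?case using p(1) by blast
qed

lemma lacunary_set_cover:
  "lacunary_set \<subseteq> (\<Union>p\<in>stage n. cball p (4 * (1 / 2) ^ coarse_exp n))"
proof -
  have "stage m \<subseteq> (\<Union>p\<in>stage n. cball p (4 * (1 / 2) ^ coarse_exp n))" for m
  proof
    fix x assume "x \<in> stage m"
    then have "x \<in> stage (max m n)" using stage_mono[OF max.cobounded1] by blast
    then obtain p where p: "p \<in> stage n"
      "dist p x \<le> 4 * ((1 / 2) ^ coarse_exp n - (1 / 2) ^ coarse_exp (max m n))"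
      using stage_near_earlier[OF _ max.cobounded2] by blast
    note p(2)
    also have "4 * ((1 / 2) ^ coarse_exp n - (1 / 2) ^ coarse_exp (max m n))
        \<le> 4 * (1 / 2 :: real) ^ coarse_exp n"
      by simp
    finally have "dist p x \<le> 4 * (1 / 2) ^ coarse_exp n" .
    then show "x \<in> (\<Union>p\<in>stage n. cball p (4 * (1 / 2) ^ coarse_exp n))" using p(1) by auto
  qed
  then have "(\<Union>m. stage m) \<subseteq> (\<Union>p\<in>stage n. cball p (4 * (1 / 2) ^ coarse_exp n))" by blast
  then show ?thesis
    unfolding lacunary_set_def by (rule closure_minimal) (intro closed_UN finite_stage ballI closed_cball)
qed

lemma compact_lacunary_set: "compact lacunary_set"
proof -
  have "bounded lacunary_set"
    using lacunary_set_cover[of 0] by (rule bounded_subset[rotated]) simp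
  then show ?thesis by (simp add: compact_eq_bounded_closed lacunary_set_def)
qed

lemma eventually_le_real_of_nat: "eventually (\<lambda>n. c \<le> real n) sequentially"
  using filterlim_real_sequentially by (simp add: filterlim_at_top)

text \<open>
  The covering by \<open>4 ^ fine_exp n\<close> balls of diameter \<open>8 * 2 ^ - coarse_exp (Suc n)\<close> has
  \<open>s\<close>-dimensional content \<open>8 powr s * 2 powr (fine_exp n * (2 - (2 * n + 2) * s))\<close>, which tends to 0
  because \<open>(2 * n + 2) * s\<close> eventually exceeds 3.
\<close>

lemma hausdorff_dim_lacunary_set: "hausdorff_dim lacunary_set = 0"
proof (rule hausdorff_dim_eq_0I, rule hausdorff_measure_eq_0I)
  fix s \<delta> \<epsilon> :: real assume pos: "s > 0" "\<delta> > 0" "\<epsilon> > 0"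
  have half: "(\<lambda>n. c * (1 / 2 :: real) ^ n) \<longlonglongrightarrow> 0" for c
    by (intro tendsto_mult_right_zero LIMSEQ_realpow_zero) auto
  have "eventually (\<lambda>n. 8 * (1 / 2 :: real) ^ n < \<delta> \<and> 8 powr s * (1 / 2) ^ n < \<epsilon> \<and>
      3 / s \<le> real n) sequentially"
    using pos
    by (intro eventually_conj order_tendstoD(2)[OF half] eventually_le_real_of_nat) auto
  then obtain n where n: "8 * (1 / 2 :: real) ^ n < \<delta>" "8 powr s * (1 / 2) ^ n < \<epsilon>"
    "3 / s \<le> real n"
    by (auto simp: eventually_sequentially)
  let ?r = "4 * (1 / 2 :: real) ^ coarse_exp (Suc n)"
  have "(1 / 2 :: real) ^ coarse_exp (Suc n) \<le> (1 / 2) ^ n"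
    using le_coarse_exp[of "Suc n"] by (intro power_decreasing) auto
  then have r: "2 * ?r \<le> \<delta>" using n(1) by linarith
  have "2 * ?r = 8 * 2 powr (- real (coarse_exp (Suc n)))"
    by (simp add: powr_minus powr_realpow power_one_over divide_simps)
  then have r_powr: "(2 * ?r) powr s = 8 powr s * 2 powr (- (real (coarse_exp (Suc n)) * s))"
    by (simp only: powr_mult powr_powr) simp
  have "real (card (stage (Suc n))) \<le> 4 ^ fine_exp n"
    using card_stage_Suc_le[of n] by (metis of_nat_le_iff of_nat_numeral of_nat_power)
  also have "\<dots> = 2 powr (2 * real (fine_exp n))"
    by (simp add: powr_realpow[symmetric] powr_powr[symmetric])
  finally have "real (card (stage (Suc n))) * (2 * ?r) powr s
      \<le> 2 powr (2 * real (fine_exp n)) * (2 * ?r) powr s"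
    by (intro mult_right_mono) auto
  also have "\<dots> = 2 powr (2 * real (fine_exp n)) *
      (8 powr s * 2 powr (- (real (coarse_exp (Suc n)) * s)))"
    by (simp only: r_powr)
  also have "\<dots>
      = 8 powr s * 2 powr (real (fine_exp n) * (2 - (2 * real n + 2) * s))"
    by (simp add: coarse_exp_Suc powr_add[symmetric] algebra_simps)
  also have "\<dots> \<le> 8 powr s * 2 powr (- real n)"
  proof (intro mult_left_mono powr_mono)
    have "3 \<le> s * real n" using n(3) pos(1) by (simp add: field_simps)
    then have "2 - (2 * real n + 2) * s \<le> - 1" using pos(1) by (simp add: algebra_simps)
    then have "real (fine_exp n) * (2 - (2 * real n + 2) * s) \<le> real (fine_exp n) * (- 1)"
      by (intro mult_left_mono) auto
    also have "\<dots> \<le> - real n" using le_fine_exp[of n] by simp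
    finally show "real (fine_exp n) * (2 - (2 * real n + 2) * s) \<le> - real n" .
  qed auto
  also have "\<dots> \<le> \<epsilon>"
    using n(2) by (simp add: powr_minus powr_realpow power_one_over divide_simps)
  finally have "real (card (stage (Suc n))) * (2 * ?r) powr s \<le> \<epsilon>" .
  then show "\<exists>P r. finite P \<and> 0 \<le> r \<and> 2 * r \<le> \<delta> \<and> lacunary_set \<subseteq> (\<Union>p\<in>P. cball p r) \<and>
      real (card P) * (2 * r) powr s \<le> \<epsilon>"
    using r lacunary_set_cover[of "Suc n"] finite_stage[of "Suc n"]
    by (intro exI[of _ "stage (Suc n)"] exI[of _ ?r]) auto
qed

section \<open>Hoelder curves are nowhere dense in the set\<close>

text \<open>
  A finite expansion may be continued by zeros and then by an arbitrary later block; these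
  translates of grids are the large separated subsets near \<open>e\<close>.
\<close>

lemma stage_translate_grid:
  assumes "e \<in> stage n" "n \<le> k"
  shows "(+) e ` grid k \<subseteq> lacunary_set"
proof -
  have "e \<in> stage k" using stage_mono[OF assms(2)] assms(1) by blast
  then have "(+) e ` grid k \<subseteq> stage (Suc k)" by auto
  also have "stage (Suc k) \<subseteq> (\<Union>n. stage n)" by (rule UN_upper) simp
  also have "\<dots> \<subseteq> lacunary_set" unfolding lacunary_set_def by (rule closure_subset)
  finally show ?thesis .
qed

text \<open>
  Near \<open>x\<close> lies a finite expansion \<open>e\<close>, and for large \<open>k\<close> the translate of \<open>grid k\<close> by \<open>e\<close>
  stays in the ball.  If the ball's part of the set were on the curve, then the pigeonhole bound would
  contradict the separation of the grid.  With \<open>a = coarse_exp k\<close> and \<open>m = 2 * k * a\<close>, the number of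
  free digits in the block, the resulting inequality reads
  \<open>2 powr ((2 * m - 1) * \<alpha> - (m + a)) \<le> L\<close>, and its exponent is
  \<open>a * (k * (4 * \<alpha> - 2) - 1) - \<alpha>\<close>.
\<close>

lemma holder_curve_nowhere_dense:
  fixes f :: "real \<Rightarrow> real ^ 2"
  assumes holder: "holder_curve \<alpha> f" and \<alpha>: "\<alpha> > 1 / 2"
    and x: "x \<in> lacunary_set" and r: "r > 0"
  shows "\<not> ball x r \<inter> lacunary_set \<subseteq> f ` {0..1}"
proof
  assume sub: "ball x r \<inter> lacunary_set \<subseteq> f ` {0..1}"
  obtain L where L: "L \<ge> 0" "\<forall>s\<in>{0..1}. \<forall>t\<in>{0..1}. dist (f s) (f t) \<le> L * \<bar>s - t\<bar> powr \<alpha>"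
    using holder by (auto simp: holder_curve_def)
  obtain e n where e: "e \<in> stage n" "dist e x < r"
    using x r by (auto simp: lacunary_set_def closure_approachable)
  have half: "(\<lambda>n. 2 * (1 / 2 :: real) ^ n) \<longlonglongrightarrow> 0"
    by (intro tendsto_mult_right_zero LIMSEQ_realpow_zero) auto
  \<comment> \<open>The lower bound \<open>(2 + \<alpha>) / (4 * \<alpha> - 2)\<close> makes the final exponent at least \<open>a\<close>.\<close>
  have "eventually (\<lambda>k. 2 * (1 / 2 :: real) ^ k < r - dist e x \<and> n \<le> k \<and> L \<le> real k \<and>
      (2 + \<alpha>) / (4 * \<alpha> - 2) \<le> real k \<and> 1 \<le> k) sequentially"
    using e(2)
    by (intro eventually_conj order_tendstoD(2)[OF half] eventually_le_real_of_nat
        eventually_ge_at_top) auto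
  then obtain k where k: "2 * (1 / 2 :: real) ^ k < r - dist e x" "n \<le> k" "L \<le> real k"
    "(2 + \<alpha>) / (4 * \<alpha> - 2) \<le> real k" "1 \<le> k"
    by (auto simp: eventually_sequentially)
  define a where "a = coarse_exp k"
  define m where "m = 2 * k * a"
  have a: "a \<ge> 1" "k \<le> a" using coarse_exp_pos[of k] le_coarse_exp[of k] by (auto simp: a_def)
  have exps: "fine_exp k = m + a" "fine_exp k - coarse_exp k = m" by (simp_all add: fine_exp_eq m_def a_def)
  have "m > 0" using a k by (simp add: m_def)
  \<comment> \<open>Half the number of grid points, so that the grid has more than \<open>N + 1\<close> points.\<close>
  define N where "N = (2::nat) ^ (2 * m - 1)"
  have "1 < N" unfolding N_def using \<open>m > 0\<close> by (intro one_less_power) auto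
  moreover have "2 * N = 4 ^ m"
    using \<open>m > 0\<close> unfolding N_def by (simp add: power_mult flip: power_Suc)
  ultimately have N: "N > 0" "N + 1 < card ((+) e ` grid k)"
    by (simp_all add: card_image card_grid exps(2))
  have real_N: "real N = 2 powr (2 * real m - 1)"
    using \<open>m > 0\<close> unfolding N_def by (simp add: of_nat_diff flip: powr_realpow)
  have "(+) e ` grid k \<subseteq> ball x r"
  proof
    fix y assume "y \<in> (+) e ` grid k"
    then obtain g where g: "g \<in> grid k" "y = e + g" by blast
    have "(1 / 2 :: real) ^ coarse_exp k \<le> (1 / 2) ^ k"
      using le_coarse_exp by (intro power_decreasing) auto
    moreover have "dist e y \<le> 2 * (1 / 2) ^ coarse_exp k"
      using norm_grid_le[OF g(1)] by (simp add: g(2) dist_norm)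
    ultimately have "dist e y \<le> 2 * (1 / 2) ^ k" by linarith
    then show "y \<in> ball x r" using k(1) dist_triangle[of x y e] by (simp add: dist_commute)
  qed
  then have "(+) e ` grid k \<subseteq> f ` {0..1}"
    using sub stage_translate_grid[OF e(1) k(2)] by blast
  then obtain y z where yz: "y \<in> (+) e ` grid k" "z \<in> (+) e ` grid k" "y \<noteq> z"
    "dist y z \<le> L * (1 / real N) powr \<alpha>"
    using holder_curve_close_points[OF L(2,1) _ N(1) _ N(2)] \<alpha> by (smt (verit) half_gt_zero)
  have "(1 / 2) ^ fine_exp k \<le> dist y z"
    using yz(1-3) grid_separated by auto
  then have "2 powr (- real (m + a)) \<le> dist y z"
    by (simp add: exps(1) powr_minus powr_realpow power_one_over divide_simps del: of_nat_add)
  also note yz(4)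
  also have "1 / real N = 2 powr (- (2 * real m - 1))"
    by (simp only: real_N powr_minus inverse_eq_divide)
  also have "(2 powr (- (2 * real m - 1))) powr \<alpha> = 2 powr (- ((2 * real m - 1) * \<alpha>))"
    by (simp only: powr_powr mult_minus_left)
  finally have "2 powr (- real (m + a)) * 2 powr ((2 * real m - 1) * \<alpha>)
      \<le> L * 2 powr (- ((2 * real m - 1) * \<alpha>)) * 2 powr ((2 * real m - 1) * \<alpha>)"
    by (intro mult_right_mono) auto
  then have "2 powr (- real (m + a) + (2 * real m - 1) * \<alpha>) \<le> L"
    by (simp add: mult.assoc flip: powr_add)
  moreover have "real a \<le> - real (m + a) + (2 * real m - 1) * \<alpha>"
  proof -
    have "2 + \<alpha> \<le> real k * (4 * \<alpha> - 2)" using k(4) \<alpha> by (simp add: field_simps)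
    then have "real a * (2 + \<alpha>) \<le> real a * (real k * (4 * \<alpha> - 2))" by (intro mult_left_mono) auto
    moreover have "1 * \<alpha> \<le> real a * \<alpha>" using a(1) \<alpha> by (intro mult_right_mono) auto
    ultimately show ?thesis by (simp add: m_def algebra_simps)
  qed
  then have "2 powr real a \<le> 2 powr (- real (m + a) + (2 * real m - 1) * \<alpha>)"
    by (intro powr_mono) auto
  moreover have "real a < 2 powr real a"
    by (simp add: powr_realpow)
  ultimately show False using k(3) a(2) by linarith
qed

theorem corollary1p5:
  shows "\<exists>K :: (real ^ 2) set. compact K \<and> hausdorff_dim K = 0 \<and>
    (\<forall>\<alpha> > 1 / 2. \<not> (\<exists>f :: nat \<Rightarrow> real \<Rightarrow> real ^ 2.
       (\<forall>i. holder_curve \<alpha> (f i)) \<and> K \<subseteq> (\<Union>i. f i ` {0..1})))"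
proof (intro exI[of _ lacunary_set] conjI allI impI notI)
  show "compact lacunary_set" by (rule compact_lacunary_set)
  show "hausdorff_dim lacunary_set = 0" by (rule hausdorff_dim_lacunary_set)
  fix \<alpha> :: real
  assume \<alpha>: "\<alpha> > 1 / 2"
  assume "\<exists>f :: nat \<Rightarrow> real \<Rightarrow> real ^ 2.
    (\<forall>i. holder_curve \<alpha> (f i)) \<and> lacunary_set \<subseteq> (\<Union>i. f i ` {0..1})"
  then obtain f :: "nat \<Rightarrow> real \<Rightarrow> real ^ 2"
    where f: "\<And>i. holder_curve \<alpha> (f i)" and cover: "lacunary_set \<subseteq> (\<Union>i. f i ` {0..1})"
    by blast
  have "closed (f i ` {0..1})" for i
    using holder_curve_continuous_on[OF f[of i]] \<alpha>
    by (intro compact_imp_closed compact_continuous_image) auto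
  then have op: "openin (top_of_set lacunary_set) (lacunary_set - f i ` {0..1})" for i
    by (metis Diff_eq open_Compl openin_open_Int)
  have dense: "lacunary_set \<subseteq> closure (lacunary_set - f i ` {0..1})" for i
  proof
    fix x assume x: "x \<in> lacunary_set"
    show "x \<in> closure (lacunary_set - f i ` {0..1})"
      unfolding closure_approachable
      using holder_curve_nowhere_dense[OF f \<alpha> x] by (fastforce simp: dist_commute)
  qed
  have "lacunary_set \<subseteq> closure (\<Inter>i. lacunary_set - f i ` {0..1})"
    by (rule Baire) (use compact_lacunary_set op dense in \<open>auto intro: compact_imp_closed\<close>)
  moreover have "(\<Inter>i. lacunary_set - f i ` {0..1}) = {}" using cover by blast
  ultimately have "lacunary_set \<subseteq> closure {}" by (simp only:)
  then show False using zero_in_lacunary_set by simp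
qed

end
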